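(* Let $n\ge 1$ be an integer, let $p\in(0,1)$, and consider the LECS prior with fixed retention probability $p$ on $n$ nodes with $k=2$ communities. For each layer $\ell\ge 1$ and each $i\in\{0,1,\dots,n\}$, let $P_i^{(\ell)}=\mathbb{P}(n_1^{(\ell)}=i)$ be the probability that community $1$ has exactly $i$ nodes in layer $\ell$. Then, for every $i\in\{0,\dots,n\}$, as $\ell\to\infty$, $$P_i^{(\ell)}\;\longrightarrow\;\frac{(1-p^{i+1})(1-p^{n-i+1})}{\sum_{j=0}^n(1-p^{j+1})(1-p^{n-j+1})}\,.$$
   Context: A weak composition of a non-negative integer $m$ into $k$ parts is an ordered $k$-tuple of non-negative integers that sum to $m$; $\mathcal{C}_m^k$ is the set of all of them. For an integer $m\ge 0$ and $p\in(0,1)$, $\overline{\mathrm{Geom}}(m,p)$ is the distribution on $\{0,\dots,m\}$ whose probability mass function at $j$ is proportional to $p^{m-j}$. The layerwise-exchangeable count-splitting (LECS) prior with fixed retention probability $p$, on $n$ nodes and $k$ communities, is the law of the following random sequence of community assignments $g_{(\ell)}=(g_{(1,\ell)},\dots,g_{(n,\ell)})\in\{1,\dots,k\}^n$, $\ell=1,2,3,\dots$ (layers). Let $n_r^{(\ell)}=|\{i: g_{(i,\ell)}=r\}|$ be the size of community $r$ in layer $\ell$. First layer: $\pi\sim\mathrm{Dir}(1,\dots,1)$ (uniform on the probability simplex in $\mathbb{R}^k$) and, conditional on $\pi$, the labels $g_{(1,1)},\dots,g_{(n,1)}$ are i.i.d. with distribution $\pi$. Layer $\ell\ge 2$: given the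 assignments in layers $1,\dots,\ell-1$, do the following independently for each $r\in\{1,\dots,k\}$ (depending only on layer $\ell-1$). Draw the number of nodes of community $r$ that remain in $r$, $c_{rr}^{(\ell)}\sim\overline{\mathrm{Geom}}(n_r^{(\ell-1)},p)$. Given $c_{rr}^{(\ell)}$, draw $(c_{rs}^{(\ell)})_{s\ne r}$ uniformly from $\mathcal{C}^{k-1}_{n_r^{(\ell-1)}-c_{rr}^{(\ell)}}$; here $c_{rs}^{(\ell)}$ is the number of nodes in community $r$ in layer $\ell-1$ that are in community $s$ in layer $\ell$. (For $k=2$ and $s\neq r$, this forces $c_{rs}^{(\ell)}=n_r^{(\ell-1)}-c_{rr}^{(\ell)}$.) Given these counts, assign layer-$\ell$ labels to the nodes $\{i:g_{(i,\ell-1)}=r\}$ uniformly at random among all labelings of these nodes with exactly $c_{rs}^{(\ell)}$ nodes receiving label $s$ for each $s$. Thus $n_s^{(\ell)}=\sum_{r}c_{rs}^{(\ell)}$. *)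

theory Defs
  imports "HOL-Probability.Probability"
begin

text \<open>
  Nodes are \<open>{1..n}\<close>, communities are \<open>{1..k}\<close>.  A community assignment is a function
  \<open>g :: nat \<Rightarrow> nat\<close> sending node \<open>i\<close> to its community; assignments are taken extensional, i.e.
  with value \<open>undefined\<close> outside \<open>{1..n}\<close>.
\<close>

definition comm_nodes :: "nat \<Rightarrow> (nat \<Rightarrow> nat) \<Rightarrow> nat \<Rightarrow> nat set" where
  "comm_nodes n g r = {i \<in> {1..n}. g i = r}"

definition comm_size :: "nat \<Rightarrow> (nat \<Rightarrow> nat) \<Rightarrow> nat \<Rightarrow> nat" where
  "comm_size n g r = card (comm_nodes n g r)"


subsection \<open>The first layer\<close>

definition prob_simplex :: "nat \<Rightarrow> (nat \<Rightarrow> real) set" where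
  "prob_simplex k =
     {\<pi> \<in> {1..k} \<rightarrow>\<^sub>E UNIV. (\<forall>r\<in>{1..k}. 0 \<le> \<pi> r) \<and> (\<Sum>r\<in>{1..k}. \<pi> r) = 1}"

text \<open>
  As usual for Dirichlet distributions, \<open>Dir(1,\<dots>,1)\<close> has constant density with respect to
  Lebesgue measure in the first \<open>k - 1\<close> coordinates, the last one being determined by them.
\<close>

definition corner_simplex :: "nat \<Rightarrow> (nat \<Rightarrow> real) set" where
  "corner_simplex k =
     {x \<in> {1..<k} \<rightarrow>\<^sub>E UNIV. (\<forall>r\<in>{1..<k}. 0 \<le> x r) \<and> (\<Sum>r\<in>{1..<k}. x r) \<le> 1}"

definition add_last_coord :: "nat \<Rightarrow> (nat \<Rightarrow> real) \<Rightarrow> nat \<Rightarrow> real" where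
  "add_last_coord k x = (\<lambda>r\<in>{1..k}. if r = k then 1 - (\<Sum>s\<in>{1..<k}. x s) else x r)"

definition flat_dirichlet :: "nat \<Rightarrow> (nat \<Rightarrow> real) measure" where
  "flat_dirichlet k =
     distr (uniform_measure
              (restrict_space (PiM {1..<k} (\<lambda>_. lborel)) (corner_simplex k)) (corner_simplex k))
           (restrict_space (PiM {1..k} (\<lambda>_. borel)) (prob_simplex k))
           (add_last_coord k)"

definition label_pmf :: "nat \<Rightarrow> (nat \<Rightarrow> real) \<Rightarrow> nat pmf" where
  "label_pmf k \<pi> = embed_pmf (\<lambda>r. if r \<in> {1..k} then \<pi> r else 0)"

definition first_layer :: "nat \<Rightarrow> nat \<Rightarrow> (nat \<Rightarrow> nat) measure" where
  "first_layer n k =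
     flat_dirichlet k \<bind> (\<lambda>\<pi>. measure_pmf (Pi_pmf {1..n} undefined (\<lambda>_. label_pmf k \<pi>)))"


subsection \<open>Transition between consecutive layers\<close>

definition geom_bar :: "nat \<Rightarrow> real \<Rightarrow> nat pmf" where
  "geom_bar m p = embed_pmf (\<lambda>j. if j \<le> m then p ^ (m - j) / (\<Sum>i\<le>m. p ^ (m - i)) else 0)"

text \<open>Weak compositions of \<open>m\<close>, with the parts indexed by the finite set \<open>I\<close>.\<close>

definition weak_comps :: "nat set \<Rightarrow> nat \<Rightarrow> (nat \<Rightarrow> nat) set" where
  "weak_comps I m = {c \<in> I \<rightarrow>\<^sub>E UNIV. (\<Sum>s\<in>I. c s) = m}"

text \<open>Joint law of \<open>(c\<^sub>r\<^sub>s)\<^sub>s\<close> for a community \<open>r\<close> that has \<open>m\<close> nodes.\<close>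

definition split_counts :: "nat \<Rightarrow> real \<Rightarrow> nat \<Rightarrow> nat \<Rightarrow> (nat \<Rightarrow> nat) pmf" where
  "split_counts k p r m = do {
     stay \<leftarrow> geom_bar m p;
     c \<leftarrow> pmf_of_set (weak_comps ({1..k} - {r}) (m - stay));
     return_pmf (c(r := stay))
   }"

definition labelings :: "nat \<Rightarrow> nat set \<Rightarrow> (nat \<Rightarrow> nat) \<Rightarrow> (nat \<Rightarrow> nat) set" where
  "labelings k V c = {h \<in> V \<rightarrow>\<^sub>E {1..k}. \<forall>s\<in>{1..k}. card {i \<in> V. h i = s} = c s}"

definition relabel :: "nat \<Rightarrow> real \<Rightarrow> nat \<Rightarrow> nat set \<Rightarrow> (nat \<Rightarrow> nat) pmf" where
  "relabel k p r V = do {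
     c \<leftarrow> split_counts k p r (card V);
     pmf_of_set (labelings k V c)
   }"

text \<open>
  The relabelings \<open>H r\<close> of the individual communities are drawn independently and glued together:
  node \<open>i\<close> takes its new label from the relabeling of its old community \<open>g i\<close>.
\<close>

definition next_layer :: "nat \<Rightarrow> nat \<Rightarrow> real \<Rightarrow> (nat \<Rightarrow> nat) \<Rightarrow> (nat \<Rightarrow> nat) pmf" where
  "next_layer n k p g =
     map_pmf (\<lambda>H. \<lambda>i\<in>{1..n}. H (g i) i)
       (Pi_pmf {1..k} undefined (\<lambda>r. relabel k p r (comm_nodes n g r)))"


subsection \<open>The law of the whole sequence of layers\<close>

text \<open>
  The Ionescu-Tulcea construction numbers its coordinates from \<open>0\<close>: the kernel
  \<open>LECS_kernel n k p j\<close> gives the conditional law of layer \<open>j + 1\<close> given the layers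
  \<open>\<omega> 0, \<dots>, \<omega> (j - 1)\<close>, which are layers \<open>1, \<dots>, j\<close>.  In \<open>LECS\<close> the coordinates are renumbered,
  so that \<open>g l\<close> is layer \<open>l\<close> for \<open>l \<ge> 1\<close>.
\<close>

definition LECS_kernel ::
  "nat \<Rightarrow> nat \<Rightarrow> real \<Rightarrow> nat \<Rightarrow> (nat \<Rightarrow> nat \<Rightarrow> nat) \<Rightarrow> (nat \<Rightarrow> nat) measure" where
  "LECS_kernel n k p j \<omega> =
     (if j = 0 then first_layer n k else measure_pmf (next_layer n k p (\<omega> (j - 1))))"

definition LECS :: "nat \<Rightarrow> nat \<Rightarrow> real \<Rightarrow> (nat \<Rightarrow> nat \<Rightarrow> nat) measure" where
  "LECS n k p =
     distr (projective_family.lim UNIV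
              (Ionescu_Tulcea.CI (LECS_kernel n k p) (\<lambda>_. count_space UNIV))
              (\<lambda>_. count_space UNIV))
           (PiM {1..} (\<lambda>_. count_space UNIV))
           (\<lambda>\<omega>. \<lambda>l\<in>{1..}. \<omega> (l - 1))"


subsection \<open>Well-definedness\<close>

lemma corner_simplex_sets [measurable]:
  "corner_simplex k \<in> sets (PiM {1..<k} (\<lambda>_. lborel))"
proof -
  have "corner_simplex k = {x \<in> space (PiM {1..<k} (\<lambda>_. lborel)).
          (\<forall>r\<in>{1..<k}. 0 \<le> x r) \<and> (\<Sum>r\<in>{1..<k}. x r) \<le> 1}"
    by (auto simp: corner_simplex_def space_PiM)
  also have "\<dots> \<in> sets (PiM {1..<k} (\<lambda>_. lborel))"
    by measurable
  finally show ?thesis .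
qed

lemma emeasure_corner_simplex:
  assumes "k \<ge> 1"
  shows "emeasure (PiM {1..<k} (\<lambda>_. lborel)) (corner_simplex k) \<noteq> 0"
    and "emeasure (PiM {1..<k} (\<lambda>_. lborel)) (corner_simplex k) \<noteq> \<infinity>"
proof -
  interpret product_sigma_finite "\<lambda>_::nat. lborel :: real measure" ..
  let ?M = "PiM {1..<k} (\<lambda>_. lborel :: real measure)"
  have cube: "emeasure ?M ({1..<k} \<rightarrow>\<^sub>E {0..a}) = ennreal (a ^ (k - 1))" if "a \<ge> 0" for a :: real
    using that by (subst emeasure_PiM) (auto simp: ennreal_power)
  have "{1..<k} \<rightarrow>\<^sub>E {0..1 / real k} \<subseteq> corner_simplex k"
  proof
    fix x assume x: "x \<in> {1..<k} \<rightarrow>\<^sub>E {0..1 / real k}"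
    have "(\<Sum>r\<in>{1..<k}. x r) \<le> (\<Sum>r\<in>{1..<k}. 1 / real k)"
      using x by (intro sum_mono) (auto simp: PiE_iff)
    also have "\<dots> \<le> 1"
      using assms by (simp add: field_simps)
    finally show "x \<in> corner_simplex k"
      using x by (auto simp: corner_simplex_def PiE_iff)
  qed
  from emeasure_mono[OF this corner_simplex_sets]
  have "ennreal ((1 / real k) ^ (k - 1)) \<le> emeasure ?M (corner_simplex k)"
    by (subst (asm) cube) auto
  moreover have "ennreal ((1 / real k) ^ (k - 1)) > 0"
    using assms by (simp add: ennreal_less_zero_iff)
  ultimately show "emeasure ?M (corner_simplex k) \<noteq> 0"
    by auto
  have "corner_simplex k \<subseteq> {1..<k} \<rightarrow>\<^sub>E {0..1}"
  proof
    fix x assume x: "x \<in> corner_simplex k"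
    have "x r \<le> 1" if "r \<in> {1..<k}" for r
    proof -
      have "x r \<le> (\<Sum>r\<in>{1..<k}. x r)"
        using x that by (intro member_le_sum) (auto simp: corner_simplex_def)
      with x show ?thesis by (auto simp: corner_simplex_def)
    qed
    with x show "x \<in> {1..<k} \<rightarrow>\<^sub>E {0..1}"
      by (auto simp: corner_simplex_def PiE_iff)
  qed
  then have "emeasure ?M (corner_simplex k) \<le> emeasure ?M ({1..<k} \<rightarrow>\<^sub>E {0..1})"
    by (intro emeasure_mono sets_PiM_I_finite) auto
  also have "\<dots> = 1"
    by (subst cube) auto
  finally have "emeasure ?M (corner_simplex k) < \<infinity>"
    by (rule order.strict_trans1) simp
  then show "emeasure ?M (corner_simplex k) \<noteq> \<infinity>"
    by simp
qed

lemma add_last_coord_simplex: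
  assumes "k \<ge> 1" "x \<in> corner_simplex k"
  shows "add_last_coord k x \<in> prob_simplex k"
proof -
  have "{1..k} = insert k {1..<k}"
    using assms by auto
  then have "(\<Sum>r\<in>{1..k}. add_last_coord k x r) = 
     add_last_coord k x k + (\<Sum>r\<in>{1..<k}. add_last_coord k x r)"
    by simp
  also have "\<dots> = 1"
    using assms by (simp add: add_last_coord_def)
  finally show ?thesis
    using assms by (auto simp: prob_simplex_def corner_simplex_def add_last_coord_def)
qed

lemma prob_space_flat_dirichlet:
  assumes "k \<ge> 1"
  shows "prob_space (flat_dirichlet k)"
  unfolding flat_dirichlet_def
proof (rule prob_space.prob_space_distr)
  let ?M = "PiM {1..<k} (\<lambda>_. lborel :: real measure)"
  let ?R = "restrict_space ?M (corner_simplex k)"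
  have "emeasure ?R (corner_simplex k) = emeasure ?M (corner_simplex k)"
    using corner_simplex_sets[of k]
    by (subst emeasure_restrict_space) (auto dest: sets.sets_into_space)
  with emeasure_corner_simplex[OF assms]
  show "prob_space (uniform_measure ?R (corner_simplex k))"
    by (intro prob_space_uniform_measure) auto
  have "add_last_coord k \<in> ?M \<rightarrow>\<^sub>M PiM {1..k} (\<lambda>_. borel)"
    unfolding add_last_coord_def
  proof (intro measurable_restrict)
    fix r assume r: "r \<in> {1..k}"
    show "(\<lambda>x. if r = k then 1 - (\<Sum>s\<in>{1..<k}. x s) else x r) \<in> ?M \<rightarrow>\<^sub>M borel"
      using r by (cases "r = k") simp_all
  qed
  then have "add_last_coord k \<in> ?R \<rightarrow>\<^sub>M restrict_space (PiM {1..k} (\<lambda>_. borel)) (prob_simplex k)"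
    using add_last_coord_simplex[OF assms]
    by (intro measurable_restrict_space3) auto
  then show "add_last_coord k \<in> uniform_measure ?R (corner_simplex k) \<rightarrow>\<^sub>M
      restrict_space (PiM {1..k} (\<lambda>_. borel)) (prob_simplex k)"
    by (simp cong: measurable_cong_sets)
qed

lemma space_flat_dirichlet: "space (flat_dirichlet k) = prob_simplex k"
  by (auto simp: flat_dirichlet_def space_restrict_space space_PiM prob_simplex_def)

lemma sets_flat_dirichlet [measurable_cong]:
  "sets (flat_dirichlet k) = sets (restrict_space (PiM {1..k} (\<lambda>_. borel)) (prob_simplex k))"
  by (simp add: flat_dirichlet_def)

lemma pmf_label_pmf:
  assumes "\<pi> \<in> prob_simplex k"
  shows "pmf (label_pmf k \<pi>) r = (if r \<in> {1..k} then \<pi> r else 0)"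
  unfolding label_pmf_def
proof (rule pmf_embed_pmf)
  have "(\<integral>\<^sup>+ r. ennreal (if r \<in> {1..k} then \<pi> r else 0) \<partial>count_space UNIV) =
        (\<Sum>r\<in>{1..k}. ennreal (\<pi> r))"
    by (subst nn_integral_count_space'[of "{1..k}"]) auto
  also have "\<dots> = 1"
    using assms by (subst sum_ennreal) (auto simp: prob_simplex_def)
  finally show "(\<integral>\<^sup>+ r. ennreal (if r \<in> {1..k} then \<pi> r else 0) \<partial>count_space UNIV) = 1" .
qed (use assms in \<open>auto simp: prob_simplex_def\<close>)

lemma pmf_geom_bar:
  assumes "p > 0"
  shows "pmf (geom_bar m p) j = (if j \<le> m then p ^ (m - j) / (\<Sum>i\<le>m. p ^ (m - i)) else 0)"
  unfolding geom_bar_def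
proof (rule pmf_embed_pmf)
  let ?Z = "\<Sum>i\<le>m. p ^ (m - i)"
  have Z: "?Z > 0" using assms by (intro sum_pos) auto
  have "(\<integral>\<^sup>+ j. ennreal (if j \<le> m then p ^ (m - j) / ?Z else 0) \<partial>count_space UNIV) =
        (\<Sum>j\<le>m. ennreal (p ^ (m - j) / ?Z))"
    by (subst nn_integral_count_space'[of "{..m}"]) auto
  also have "\<dots> = ennreal (\<Sum>j\<le>m. p ^ (m - j) / ?Z)"
    using assms Z by (intro sum_ennreal) auto
  also have "\<dots> = 1"
    using Z by (simp add: sum_divide_distrib[symmetric])
  finally show "(\<integral>\<^sup>+ j. ennreal (if j \<le> m then p ^ (m - j) / ?Z else 0) \<partial>count_space UNIV) = 1" .
qed (use assms in \<open>auto intro!: divide_nonneg_nonneg sum_nonneg\<close>)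

lemma measurable_first_layer_kernel [measurable]:
  "(\<lambda>\<pi>. measure_pmf (Pi_pmf {1..(n::nat)} undefined (\<lambda>_. label_pmf k \<pi>)))
     \<in> flat_dirichlet k \<rightarrow>\<^sub>M prob_algebra (count_space UNIV)" (is "?K \<in> _")
proof (rule measurable_prob_algebraI)
  show "prob_space (?K \<pi>)" for \<pi>
    by (rule prob_space_measure_pmf)
  show "?K \<in> flat_dirichlet k \<rightarrow>\<^sub>M subprob_algebra (count_space UNIV)"
  proof (rule measurable_subprob_algebra)
    fix A :: "(nat \<Rightarrow> nat) set"
    let ?F = "{1..n} \<rightarrow>\<^sub>E {1..k}"
    have fin: "finite ?F" by (intro finite_PiE) auto
    have eq: "emeasure (?K \<pi>) A = (\<Sum>g\<in>A \<inter> ?F. ennreal (\<Prod>i\<in>{1..n}. \<pi> (g i)))"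
      if \<pi>: "\<pi> \<in> space (flat_dirichlet k)" for \<pi>
    proof -
      have \<pi>': "\<pi> \<in> prob_simplex k" using \<pi> by (simp add: space_flat_dirichlet)
      have sub: "set_pmf (Pi_pmf {1..n} undefined (\<lambda>_. label_pmf k \<pi>)) \<subseteq> ?F"
        unfolding set_Pi_pmf[OF finite_atLeastAtMost] using pmf_label_pmf[OF \<pi>']
        by (auto simp: PiE_dflt_def set_pmf_eq PiE_iff extensional_def split: if_splits)
      have "emeasure (?K \<pi>) A = emeasure (?K \<pi>) (A \<inter> ?F)"
        by (intro emeasure_eq_AE) (use sub in \<open>auto simp: AE_measure_pmf_iff\<close>)
      also have "\<dots> = (\<Sum>g\<in>A \<inter> ?F. ennreal (pmf (Pi_pmf {1..n} undefined (\<lambda>_. label_pmf k \<pi>)) g))"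
        using fin by (subst emeasure_measure_pmf_finite) auto
      also have "\<dots> = (\<Sum>g\<in>A \<inter> ?F. ennreal (\<Prod>i\<in>{1..n}. \<pi> (g i)))"
      proof (intro sum.cong refl arg_cong[where f = ennreal])
        fix g assume g: "g \<in> A \<inter> ?F"
        then have "pmf (Pi_pmf {1..n} undefined (\<lambda>_. label_pmf k \<pi>)) g =
                     (\<Prod>i\<in>{1..n}. pmf (label_pmf k \<pi>) (g i))"
          by (intro pmf_Pi') auto
        also have "\<dots> = (\<Prod>i\<in>{1..n}. \<pi> (g i))"
          using g by (intro prod.cong) (auto simp: pmf_label_pmf[OF \<pi>'] PiE_iff)
        finally show "pmf (Pi_pmf {1..n} undefined (\<lambda>_. label_pmf k \<pi>)) g =
                        (\<Prod>i\<in>{1..n}. \<pi> (g i))" .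
      qed
      finally show ?thesis .
    qed
    have "(\<lambda>\<pi>. \<Sum>g\<in>A \<inter> ?F. ennreal (\<Prod>i\<in>{1..n}. \<pi> (g i))) \<in> borel_measurable (flat_dirichlet k)"
    proof (intro borel_measurable_sum measurable_compose[OF _ measurable_ennreal]
                 borel_measurable_prod)
      fix g i assume "g \<in> A \<inter> ?F" "i \<in> {1..n}"
      then have "g i \<in> {1..k}" by auto
      then have "(\<lambda>\<pi>. \<pi> (g i)) \<in> restrict_space (PiM {1..k} (\<lambda>_. borel)) (prob_simplex k) \<rightarrow>\<^sub>M borel"
        by (intro measurable_restrict_space1 measurable_component_singleton)
      then show "(\<lambda>\<pi>. \<pi> (g i)) \<in> flat_dirichlet k \<rightarrow>\<^sub>M borel"
        by (simp cong: measurable_cong_sets add: sets_flat_dirichlet)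
    qed
    then show "(\<lambda>\<pi>. emeasure (?K \<pi>) A) \<in> borel_measurable (flat_dirichlet k)"
      by (subst measurable_cong[OF eq])
  qed (auto simp: prob_space_imp_subprob_space prob_space_measure_pmf)
qed

lemma first_layer_prob_algebra:
  assumes "k \<ge> 1"
  shows "first_layer n k \<in> space (prob_algebra (count_space UNIV))"
proof -
  have D: "flat_dirichlet k \<in> space (prob_algebra (flat_dirichlet k))"
    using prob_space_flat_dirichlet[OF assms] by (simp add: space_prob_algebra)
  have "space (flat_dirichlet k) \<noteq> {}"
    by (rule prob_space.not_empty[OF prob_space_flat_dirichlet[OF assms]])
  then have "sets (first_layer n k) = sets (count_space UNIV)"
    unfolding first_layer_def by (intro sets_bind) auto
  moreover have "prob_space (first_layer n k)"
    unfolding first_layer_def by (rule prob_space_bind'[OF D measurable_first_layer_kernel])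
  ultimately show ?thesis
    by (simp add: space_prob_algebra)
qed

lemma Ionescu_Tulcea_LECS:
  assumes "k \<ge> 1"
  shows "Ionescu_Tulcea (LECS_kernel n k p) (\<lambda>_. count_space UNIV)"
proof (rule Ionescu_Tulcea.intro)
  fix j
  show "LECS_kernel n k p j \<in> PiM {0..<j} (\<lambda>_. count_space UNIV) \<rightarrow>\<^sub>M subprob_algebra (count_space UNIV)"
  proof (cases "j = 0")
    case True
    then have "LECS_kernel n k p j = (\<lambda>_. first_layer n k)"
      by (auto simp: LECS_kernel_def)
    then show ?thesis
      using first_layer_prob_algebra[OF assms]
      by (auto simp: space_prob_algebra space_subprob_algebra
               intro!: measurable_const prob_space_imp_subprob_space)
  next
    case False
    then have "LECS_kernel n k p j = (\<lambda>\<omega>. measure_pmf (next_layer n k p (\<omega> (j - 1))))"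
      by (auto simp: LECS_kernel_def)
    moreover have "(\<lambda>\<omega>. \<omega> (j - 1)) \<in> PiM {0..<j} (\<lambda>_. count_space UNIV) \<rightarrow>\<^sub>M count_space UNIV"
      using False by (intro measurable_component_singleton) auto
    then have "(\<lambda>\<omega>. measure_pmf (next_layer n k p (\<omega> (j - 1))))
      \<in> PiM {0..<j} (\<lambda>_. count_space UNIV) \<rightarrow>\<^sub>M subprob_algebra (count_space UNIV)"
      by (rule measurable_compose)
         (auto simp: measurable_count_space_eq1 space_subprob_algebra
               intro: prob_space_imp_subprob_space prob_space_measure_pmf)
    ultimately show ?thesis by simp
  qed
next
  fix j and \<omega> :: "nat \<Rightarrow> nat \<Rightarrow> nat"
  assume "\<omega> \<in> space (PiM {0..<j} (\<lambda>_. count_space UNIV))"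
  show "prob_space (LECS_kernel n k p j \<omega>)"
    using first_layer_prob_algebra[OF assms, of n]
    by (auto simp: LECS_kernel_def space_prob_algebra prob_space_measure_pmf)
qed

lemma prob_space_LECS:
  assumes "k \<ge> 1"
  shows "prob_space (LECS n k p)"
proof -
  interpret Ionescu_Tulcea "LECS_kernel n k p" "\<lambda>_. count_space UNIV"
    by (rule Ionescu_Tulcea_LECS[OF assms])
  have "(\<lambda>x. restrict x {}) \<in> PF.lim \<rightarrow>\<^sub>M PiM {} (\<lambda>_. count_space UNIV :: (nat \<Rightarrow> nat) measure)"
    by (intro measurable_restrict) auto
  moreover have "prob_space (distr PF.lim (PiM {} (\<lambda>_. count_space UNIV)) (\<lambda>x. restrict x {}))"
    by (subst distr_lim) (auto intro: PF.prob_space_P)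
  ultimately interpret L: prob_space PF.lim
    by (rule prob_space_distrD)
  show ?thesis
    unfolding LECS_def
  proof (rule L.prob_space_distr)
    have "(\<lambda>\<omega>. \<lambda>l\<in>{1..}. \<omega> (l - 1)) \<in> PiM UNIV (\<lambda>_. count_space UNIV :: (nat \<Rightarrow> nat) measure)
            \<rightarrow>\<^sub>M PiM {1..} (\<lambda>_. count_space UNIV)"
      by (intro measurable_restrict measurable_component_singleton) auto
    then show "(\<lambda>\<omega>. \<lambda>l\<in>{1..}. \<omega> (l - 1)) \<in> PF.lim \<rightarrow>\<^sub>M PiM {1..} (\<lambda>_. count_space UNIV)"
      by (simp cong: measurable_cong_sets)
  qed
qed

end

theory Submission
  imports Defs
begin

text \<open>
  For two communities the size of community 1 is itself a Markov chain on \<open>{0..n}\<close>.  From size \<open>i\<close>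
  it moves to \<open>a + c\<close>, where \<open>a \<le> i\<close> nodes stay in community 1 and \<open>c \<le> n - i\<close> nodes leave
  community 2, with probability \<open>p ^ (i - a) * p ^ c / (Z i * Z (n - i))\<close> for \<open>Z m = 1 + p + \<dots> + p ^ m\<close>.
  The probability flow from \<open>i\<close> to \<open>j\<close>, started from the weights \<open>Z i * Z (n - i)\<close>, is thus a sum
  of terms \<open>p ^ (i + j - 2 * a)\<close> over a range symmetric in \<open>i\<close> and \<open>j\<close>, so the chain is
  reversible with respect to these weights.  All its transition probabilities are positive, which
  forces convergence to the normalised weights from any initial distribution.
\<close>

section \<open>Convergence of finite chains with a positive kernel\<close>

text \<open>Doeblin's argument: a positive kernel on a finite set is bounded below by some
  \<open>\<delta> > 0\<close>, so each step shrinks the l1 distance to \<open>w\<close> by a fixed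
  factor below 1.\<close>

lemma positive_kernel_tendsto_stationary:
  fixes K :: "'a \<Rightarrow> 'a \<Rightarrow> real"
  assumes fin: "finite S"
    and pos: "\<And>i j. i \<in> S \<Longrightarrow> j \<in> S \<Longrightarrow> 0 < K i j"
    and K1: "\<And>i. i \<in> S \<Longrightarrow> (\<Sum>j\<in>S. K i j) = 1"
    and st: "\<And>j. j \<in> S \<Longrightarrow> (\<Sum>i\<in>S. w i * K i j) = w j" and w1: "(\<Sum>i\<in>S. w i) = 1"
    and q: "\<And>l j. j \<in> S \<Longrightarrow> q (Suc l) j = (\<Sum>i\<in>S. q l i * K i j)"
    and q1: "\<And>l. (\<Sum>i\<in>S. q l i) = 1"
    and j: "j \<in> S"
  shows "(\<lambda>l. q l j) \<longlonglongrightarrow> w j"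
proof -
  define \<delta> where "\<delta> = Min ((\<lambda>(i, j). K i j) ` (S \<times> S))"
  define d where "d l i = q l i - w i" for l i
  define D where "D l = (\<Sum>i\<in>S. \<bar>d l i\<bar>)" for l
  define c where "c = 1 - real (card S) * \<delta>"
  have "0 < \<delta>"
    unfolding \<delta>_def using fin j pos by (subst Min_gr_iff) auto
  moreover have "\<delta> \<le> K i j" if "i \<in> S" "j \<in> S" for i j
    unfolding \<delta>_def using fin that by (intro Min_le) auto
  ultimately have \<delta>: "0 < \<delta>" "\<And>i j. i \<in> S \<Longrightarrow> j \<in> S \<Longrightarrow> \<delta> \<le> K i j"
    by auto
  have "card S > 0" using fin j by (auto simp: card_gt_0_iff)
  then have "c < 1" using \<delta> by (simp add: c_def)
  \<comment> \<open>A row sums to 1 and has \<open>card S\<close> entries, each at least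
    \<open>\<delta>\<close>, so the contraction factor is not negative.\<close>
  have "(\<Sum>i\<in>S. \<delta>) \<le> (\<Sum>i\<in>S. K j i)" using \<delta> j by (intro sum_mono) auto
  then have "0 \<le> c" using K1[OF j] by (simp add: c_def)
  have d0: "(\<Sum>i\<in>S. d l i) = 0" for l
    by (simp add: d_def sum_subtractf q1 w1)
  \<comment> \<open>Since \<open>d l\<close> has total mass \<open>0\<close>, the kernel may be lowered by its minimum \<open>\<delta>\<close>; the row sums
     of the lowered kernel, and hence the contraction factor, are \<open>c\<close>.\<close>
  have dstep: "d (Suc l) j = (\<Sum>i\<in>S. d l i * (K i j - \<delta>))" if "j \<in> S" for l j
  proof -
    have "(\<Sum>i\<in>S. d l i * (K i j - \<delta>)) = (\<Sum>i\<in>S. d l i * K i j) - (\<Sum>i\<in>S. d l i) * \<delta>"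
      by (simp add: right_diff_distrib sum_subtractf sum_distrib_right)
    then show ?thesis
      \<comment> \<open>The first \<open>simp\<close> must apply \<open>d0\<close> while
        \<open>d\<close> is still folded; only then is \<open>d\<close> expanded.\<close>
      using q[OF that, of l] st[OF that] by (simp add: d0) (simp add: d_def left_diff_distrib sum_subtractf)
  qed
  have Dstep: "D (Suc l) \<le> c * D l" for l
  proof -
    have "D (Suc l) \<le> (\<Sum>j\<in>S. \<Sum>i\<in>S. \<bar>d l i\<bar> * (K i j - \<delta>))"
      unfolding D_def
    proof (rule sum_mono)
      fix j assume j: "j \<in> S"
      have "\<bar>d (Suc l) j\<bar> \<le> (\<Sum>i\<in>S. \<bar>d l i * (K i j - \<delta>)\<bar>)"
        unfolding dstep[OF j] by (rule sum_abs)
      also have "\<dots> = (\<Sum>i\<in>S. \<bar>d l i\<bar> * (K i j - \<delta>))"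
        using \<delta> j by (intro sum.cong) (auto simp: abs_mult)
      finally show "\<bar>d (Suc l) j\<bar> \<le> (\<Sum>i\<in>S. \<bar>d l i\<bar> * (K i j - \<delta>))" .
    qed
    also have "\<dots> = (\<Sum>i\<in>S. \<bar>d l i\<bar> * (\<Sum>j\<in>S. K i j - \<delta>))"
      by (subst sum.swap) (simp add: sum_distrib_left)
    also have "\<dots> = c * D l"
      by (simp add: sum_subtractf K1 c_def D_def sum_distrib_left mult.commute)
    finally show ?thesis .
  qed
  have "D l \<le> c ^ l * D 0" for l
  proof (induction l)
    case (Suc l)
    show ?case using Dstep[of l] mult_left_mono[OF Suc \<open>0 \<le> c\<close>] by (simp add: mult.assoc)
  qed simp
  moreover have "\<bar>d l j\<bar> \<le> D l" for l
    unfolding D_def using fin j by (intro member_le_sum) auto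
  ultimately have bd: "norm (d l j) \<le> c ^ l * D 0" for l
    by (metis order_trans real_norm_def)
  have "(\<lambda>l. c ^ l * D 0) \<longlonglongrightarrow> 0"
    using \<open>0 \<le> c\<close> \<open>c < 1\<close> by (intro tendsto_mult_left_zero LIMSEQ_power_zero) auto
  then have "(\<lambda>l. d l j) \<longlonglongrightarrow> 0"
    by (rule Lim_null_comparison[rotated]) (use bd in auto)
  then show ?thesis
    unfolding d_def by (rule LIM_zero_cancel)
qed

section \<open>Marginals of the Ionescu-Tulcea limit\<close>

text \<open>\<open>CI J\<close> is a projection of the iterated kernel up to \<open>up_to J\<close>;
  for an initial segment nothing is projected away.\<close>

lemma (in Ionescu_Tulcea) distr_lim_initial:
  "distr PF.lim (PiM {0..<k} M) (\<lambda>\<omega>. restrict \<omega> {0..<k}) = C 0 k (\<lambda>_. undefined)"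
proof -
  have "up_to {0..<k} \<le> k"
    by (simp add: up_to_iff_Ico)
  moreover have "k \<le> up_to {0..<k}"
    using up_to_less[of "{0..<k}" "k - 1"] by (cases k) auto
  ultimately have "up_to {0..<k} = k"
    by simp
  then show ?thesis
    using distr_C[of k k "\<lambda>_. undefined" 0] by (simp add: distr_lim CI_def space_PiM)
qed

text \<open>The event depends on the first \<open>Suc m\<close> coordinates only, whose law is that
  of the first \<open>m\<close> followed by one application of \<open>eP m\<close>.\<close>

lemma (in Ionescu_Tulcea) emeasure_lim_component:
  assumes A: "A \<in> sets (M m)"
  shows "emeasure PF.lim {\<omega> \<in> space PF.lim. \<omega> m \<in> A} =
           (\<integral>\<^sup>+ \<omega>. emeasure (P m (restrict \<omega> {0..<m})) A \<partial>PF.lim)"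
proof -
  \<comment> \<open>The empty history, the only point of the product over
    \<open>{0..<0}\<close>.\<close>
  let ?u = "\<lambda>_. undefined :: 'a"
  let ?B = "{x \<in> space (PiM {0..<Suc m} M). x m \<in> A}"
  have [measurable]: "?B \<in> sets (PiM {0..<Suc m} M)"
    using A by measurable
  have rM: "(\<lambda>\<omega>. restrict \<omega> {0..<k}) \<in> PF.lim \<rightarrow>\<^sub>M PiM {0..<k} M" for k
    by (simp add: measurable_cong_sets[OF PF.sets_lim refl] measurable_restrict_subset)
  have u: "?u \<in> space (PiM {0..<0} M)"
    by (simp add: space_PiM)
  have "emeasure PF.lim {\<omega> \<in> space PF.lim. \<omega> m \<in> A} =
          emeasure (distr PF.lim (PiM {0..<Suc m} M) (\<lambda>\<omega>. restrict \<omega> {0..<Suc m})) ?B"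
    by (subst emeasure_distr[OF rM], fact)
       (auto intro!: arg_cong[where f = "emeasure _"] simp: space_PiM PiE_iff)
  also have "\<dots> = emeasure (C 0 m ?u \<bind> eP m) ?B"
    by (simp add: distr_lim_initial del: restrict_apply)
  also have "\<dots> = (\<integral>\<^sup>+ x. emeasure (eP m x) ?B \<partial>C 0 m ?u)"
  proof (rule emeasure_bind)
    show "space (C 0 m ?u) \<noteq> {}"
      using prob_space.not_empty[OF prob_space_C[OF u]] .
    show "eP m \<in> C 0 m ?u \<rightarrow>\<^sub>M subprob_algebra (PiM {0..<Suc m} M)"
      using measurable_eP[of m] sets_C[OF u, of m] by (simp cong: measurable_cong_sets)
  qed measurable
  also have "\<dots> = (\<integral>\<^sup>+ x. emeasure (P m x) A \<partial>C 0 m ?u)"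
  proof (rule nn_integral_cong)
    fix x assume "x \<in> space (C 0 m ?u)"
    then have x: "x \<in> space (PiM {0..<m} M)"
      by (simp add: space_C[OF u])
    \<comment> \<open>\<open>eP m x\<close> appends a draw from \<open>P m x\<close> as coordinate
      \<open>m\<close>, and \<open>?B\<close> constrains that coordinate alone.\<close>
    have "(\<lambda>y. x(m := y)) -` ?B \<inter> space (M m) = A"
      using sets.sets_into_space[OF A] x by (auto simp: space_PiM PiE_iff extensional_def)
    then show "emeasure (eP m x) ?B = emeasure (P m x) A"
      by (simp add: emeasure_eP[OF x])
  qed
  also have "\<dots> = (\<integral>\<^sup>+ \<omega>. emeasure (P m (restrict \<omega> {0..<m})) A \<partial>PF.lim)"
    unfolding distr_lim_initial[symmetric]
    by (rule nn_integral_distr[OF rM]) (use A in measurable)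
  finally show ?thesis .
qed

section \<open>Transitions for two communities\<close>

lemma set_pmf_geom_bar:
  assumes "p > 0"
  shows "set_pmf (geom_bar m p) \<subseteq> {..m}"
  using assms by (auto simp: set_pmf_eq pmf_geom_bar split: if_splits)

lemma weak_comps_singleton: "weak_comps {s} q = {\<lambda>x\<in>{s}. q}"
  by (auto simp: weak_comps_def PiE_iff extensional_def fun_eq_iff)

text \<open>The community other than \<open>r\<close> is \<open>3 - r\<close>, and a composition
  into one part is forced, so only the number of stayers is random.\<close>

lemma split_counts_two:
  assumes "r \<in> {1..2}"
  shows "split_counts 2 p r m =
           map_pmf (\<lambda>a. (\<lambda>x\<in>{3 - r}. m - a)(r := a)) (geom_bar m p)"
proof -
  have "r = 1 \<or> r = 2"
    using assms by auto
  then have "{1..2} - {r} = {3 - r}"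
    by auto
  then show ?thesis
    by (simp add: split_counts_def weak_comps_singleton pmf_of_set_singleton bind_return_pmf map_pmf_def)
qed

lemma sum_split_counts_two:
  assumes "p > 0" "r \<in> {1..2}" "c \<in> set_pmf (split_counts 2 p r m)"
  shows "c 1 + c 2 = m"
proof -
  have "r = 1 \<or> r = 2" using assms(2) by auto
  then show ?thesis
    using assms set_pmf_geom_bar[OF assms(1), of m] by (auto simp: split_counts_two)
qed

text \<open>Needed because \<open>pmf_of_set\<close> is the uniform law only on a nonempty finite
  set.\<close>

lemma labelings_two_nonempty:
  assumes "finite V" "c 1 + c 2 = card V"
  shows "labelings 2 V c \<noteq> {}"
proof -
  obtain W where W: "W \<subseteq> V" "card W = c 1"
    using obtain_subset_with_card_n[of "c 1" V] assms by auto
  let ?h = "\<lambda>i\<in>V. if i \<in> W then 1 else 2 :: nat"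
  have "{i \<in> V. ?h i = 1} = W" "{i \<in> V. ?h i = 2} = V - W"
    using W by auto
  moreover have "card (V - W) = c 2"
    using assms W by (simp add: card_Diff_subset finite_subset)
  moreover have "{1..2} = {1, 2 :: nat}"
    by auto
  ultimately have "?h \<in> labelings 2 V c"
    using W by (simp add: labelings_def)
  then show ?thesis by blast
qed

lemma finite_labelings: "finite V \<Longrightarrow> finite (labelings k V c)"
  by (rule finite_subset[of _ "V \<rightarrow>\<^sub>E {1..k}"]) (auto simp: labelings_def intro: finite_PiE)

lemma set_pmf_labelings_two:
  assumes "p > 0" "r \<in> {1..2}" "finite V" "c \<in> set_pmf (split_counts 2 p r (card V))"
  shows "set_pmf (pmf_of_set (labelings 2 V c)) = labelings 2 V c"
  using assms labelings_two_nonempty finite_labelings sum_split_counts_two by (intro set_pmf_of_set) auto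

lemma set_pmf_relabel_two:
  assumes "p > 0" "r \<in> {1..2}" "finite V"
  shows "set_pmf (relabel 2 p r V) \<subseteq> V \<rightarrow>\<^sub>E {1..2}"
  unfolding relabel_def
  using set_pmf_labelings_two[OF assms] by (auto simp: labelings_def)

text \<open>All labelings with counts \<open>c\<close> have the same number of labels 1, so the
  uniform choice among them has no effect on this count.\<close>

lemma relabel_two_count:
  assumes "p > 0" "r \<in> {1..2}" "finite V"
  shows "map_pmf (\<lambda>h. card {i \<in> V. h i = 1}) (relabel 2 p r V) =
           map_pmf (\<lambda>c. c 1) (split_counts 2 p r (card V))"
proof -
  have "map_pmf (\<lambda>h. card {i \<in> V. h i = 1}) (pmf_of_set (labelings 2 V c)) = return_pmf (c 1)"
    if c: "c \<in> set_pmf (split_counts 2 p r (card V))" for c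
  proof -
    have "map_pmf (\<lambda>h. card {i \<in> V. h i = 1}) (pmf_of_set (labelings 2 V c)) =
            map_pmf (\<lambda>_. c 1) (pmf_of_set (labelings 2 V c))"
      by (rule map_pmf_cong[OF refl])
         (unfold set_pmf_labelings_two[OF assms c], auto simp: labelings_def)
    then show ?thesis by simp
  qed
  then show ?thesis
    unfolding relabel_def map_bind_pmf
    by (subst (2) map_pmf_def) (auto intro: bind_pmf_cong)
qed

text \<open>Here \<open>a\<close> and \<open>b\<close> count the nodes that stay in communities 1 and 2, respectively.\<close>

definition size_step :: "nat \<Rightarrow> real \<Rightarrow> nat \<Rightarrow> nat pmf" where
  "size_step n p i =
     map_pmf (\<lambda>(a, b). a + (n - i - b)) (pair_pmf (geom_bar i p) (geom_bar (n - i) p))"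

text \<open>Peeling both indices off \<open>Pi_pmf\<close> leaves an independent pair, through which
  counts can be pushed with \<open>map_pair\<close>.\<close>

lemma next_layer_two:
  "next_layer n 2 p g =
     map_pmf (\<lambda>(h\<^sub>1, h\<^sub>2). \<lambda>i\<in>{1..n}. ((\<lambda>_. undefined)(2 := h\<^sub>2, 1 := h\<^sub>1)) (g i) i)
       (pair_pmf (relabel 2 p 1 (comm_nodes n g 1)) (relabel 2 p 2 (comm_nodes n g 2)))"
proof -
  have "{1..2} = insert 1 (insert 2 ({} :: nat set))" by auto
  then show ?thesis
    by (simp add: next_layer_def Pi_pmf_insert map_pmf_comp pair_map_pmf2 case_prod_unfold
        pair_return_pmf2)
qed

lemma labels_two:
  fixes g :: "nat \<Rightarrow> nat"
  assumes "g \<in> {1..n} \<rightarrow>\<^sub>E {1..2}" "i \<in> {1..n}"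
  shows "g i = 1 \<or> g i = 2"
  using PiE_mem[OF assms] by auto

lemma finite_comm_nodes [simp]: "finite (comm_nodes n g r)"
  by (simp add: comm_nodes_def)

lemma set_pmf_next_layer_two:
  assumes "p > 0" "g \<in> {1..n} \<rightarrow>\<^sub>E {1..2}"
  shows "set_pmf (next_layer n 2 p g) \<subseteq> {1..n} \<rightarrow>\<^sub>E {1..2}"
proof -
  have 1: "set_pmf (relabel 2 p r (comm_nodes n g r)) \<subseteq> comm_nodes n g r \<rightarrow>\<^sub>E {1..2}"
    if "r \<in> {1..2}" for r
    using set_pmf_relabel_two[OF assms(1) that] by simp
  show ?thesis
  proof
    fix x assume "x \<in> set_pmf (next_layer n 2 p g)"
    then obtain h1 h2 where x: "x = (\<lambda>i\<in>{1..n}. ((\<lambda>_. undefined)(2 := h2, 1 := h1)) (g i) i)"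
      and "h1 \<in> set_pmf (relabel 2 p 1 (comm_nodes n g 1))"
          "h2 \<in> set_pmf (relabel 2 p 2 (comm_nodes n g 2))"
      unfolding next_layer_two by (auto simp del: One_nat_def)
    then have h: "h1 \<in> comm_nodes n g 1 \<rightarrow>\<^sub>E {1..2}" "h2 \<in> comm_nodes n g 2 \<rightarrow>\<^sub>E {1..2}"
      using 1[of 1] 1[of 2] by auto
    have "x i \<in> {1..2}" if "i \<in> {1..n}" for i
      using labels_two[OF assms(2) that] h that PiE_mem[OF h(1), of i] PiE_mem[OF h(2), of i]
      by (auto simp: x comm_nodes_def)
    then show "x \<in> {1..n} \<rightarrow>\<^sub>E {1..2}"
      by (auto simp: x)
  qed
qed

lemma comm_size_two:
  assumes "g \<in> {1..n} \<rightarrow>\<^sub>E {1..2}"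
  shows "comm_size n g 2 = n - comm_size n g 1"
proof -
  have "comm_nodes n g 2 = {1..n} - comm_nodes n g 1"
    using labels_two[OF assms] by (fastforce simp: comm_nodes_def)
  moreover have "comm_nodes n g 1 \<subseteq> {1..n}"
    by (auto simp: comm_nodes_def)
  ultimately show ?thesis
    by (simp add: comm_size_def card_Diff_subset)
qed

text \<open>Lumpability: the new community 1 consists of the stayers of community 1 and the leavers
  of community 2, and the laws of both counts involve \<open>g\<close> only through the community
  sizes.\<close>

lemma comm_size_next_layer_two:
  assumes p: "p > 0" and g: "g \<in> {1..n} \<rightarrow>\<^sub>E {1..2}"
  shows "map_pmf (\<lambda>h. comm_size n h 1) (next_layer n 2 p g) = size_step n p (comm_size n g 1)"
proof -
  let ?V = "comm_nodes n g"
  let ?f = "\<lambda>r h. card {i \<in> ?V r. h i = (1 :: nat)}"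
  have cnt: "comm_size n (\<lambda>i\<in>{1..n}. ((\<lambda>_. undefined)(2 := h2, 1 := h1)) (g i) i) 1 = ?f 1 h1 + ?f 2 h2"
    for h1 h2
  proof -
    have "comm_nodes n (\<lambda>i\<in>{1..n}. ((\<lambda>_. undefined)(2 := h2, 1 := h1)) (g i) i) 1 =
            {i \<in> ?V 1. h1 i = 1} \<union> {i \<in> ?V 2. h2 i = 1}"
      using labels_two[OF g] by (fastforce simp: comm_nodes_def split: if_splits)
    then show ?thesis
      unfolding comm_size_def
      by (subst card_Un_disjoint[symmetric]) (auto simp: comm_nodes_def)
  qed
  have "map_pmf (\<lambda>h. comm_size n h 1) (next_layer n 2 p g) =
          map_pmf (\<lambda>(x, y). x + y)
            (pair_pmf (map_pmf (?f 1) (relabel 2 p 1 (?V 1))) (map_pmf (?f 2) (relabel 2 p 2 (?V 2))))"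
    unfolding next_layer_two
    by (simp add: map_pmf_comp map_pair[symmetric] case_prod_unfold cnt del: One_nat_def fun_upd_apply)
  \<comment> \<open>\<open>geom_bar\<close> counts stayers, so for community 2 the number of new
    labels 1 is the complement \<open>card (?V 2) - b\<close>.\<close>
  also have "\<dots> = map_pmf (\<lambda>(x, y). x + y)
            (pair_pmf (geom_bar (card (?V 1)) p)
              (map_pmf (\<lambda>b. card (?V 2) - b) (geom_bar (card (?V 2)) p)))"
    using p by (simp add: relabel_two_count split_counts_two map_pmf_comp del: One_nat_def)
  also have "\<dots> = size_step n p (comm_size n g 1)"
    using comm_size_two[OF g]
    by (simp add: size_step_def comm_size_def pair_map_pmf2 map_pmf_comp case_prod_unfold)
  finally show ?thesis .
qed

section \<open>Reversibility of the size chain\<close>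

lemma pmf_geom_bar':
  assumes "p > 0"
  shows "pmf (geom_bar m p) j = (if j \<le> m then p ^ (m - j) / (\<Sum>i\<le>m. p ^ i) else 0)"
proof -
  have "(\<Sum>i\<le>m. p ^ (m - i)) = (\<Sum>i\<le>m. p ^ i)"
    using sum.atLeastAtMost_rev[of "\<lambda>i. p ^ i" 0 m] by (simp add: atLeast0AtMost)
  then show ?thesis
    by (simp add: pmf_geom_bar[OF assms])
qed

text \<open>The product of the two \<open>geom_bar\<close> normalising constants at size
  \<open>i\<close>; multiplying by it clears the denominators of \<open>size_step\<close>.\<close>

definition size_weight :: "nat \<Rightarrow> real \<Rightarrow> nat \<Rightarrow> real" where
  "size_weight n p i = (\<Sum>a\<le>i. p ^ a) * (\<Sum>b\<le>n - i. p ^ b)"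

lemma size_weight_pos: "p > 0 \<Longrightarrow> size_weight n p i > 0"
  unfolding size_weight_def by (intro mult_pos_pos sum_pos) auto

text \<open>Both geometric sums telescope against \<open>1 - p\<close>; the factor
  \<open>(1 - p)\<^sup>2\<close> does not depend on \<open>i\<close> and cancels in the normalised
  weights.\<close>

lemma size_weight_eq: "(1 - p)\<^sup>2 * size_weight n p i = (1 - p ^ (i + 1)) * (1 - p ^ (n - i + 1))"
proof -
  have "(1 - p)\<^sup>2 * size_weight n p i = ((1 - p) * (\<Sum>a\<le>i. p ^ a)) * ((1 - p) * (\<Sum>b\<le>n - i. p ^ b))"
    by (simp add: size_weight_def power2_eq_square)
  then show ?thesis
    by (simp only: sum_gp_basic Suc_eq_plus1)
qed

text \<open>If \<open>a\<close> nodes stay in community 1, then reaching size \<open>j\<close> takes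
  exactly \<open>j - a\<close> leavers from the \<open>n - i\<close> nodes of community 2.\<close>

lemma size_weight_step:
  assumes p: "p > 0"
  shows "size_weight n p i * pmf (size_step n p i) j =
           (\<Sum>a | a \<le> i \<and> a \<le> j \<and> j - a \<le> n - i. p ^ (i - a) * p ^ (j - a))"
proof -
  define m where "m = n - i"
  let ?Z = "\<lambda>m. \<Sum>a\<le>m. p ^ a"
  have Z: "?Z m > 0" for m using p by (intro sum_pos) auto
  have inner: "pmf (geom_bar m p \<bind> (\<lambda>b. return_pmf (a + (m - b)))) j =
          (if a \<le> j \<and> j - a \<le> m then p ^ (j - a) / ?Z m else 0)" (is "_ = ?R a") for a
  proof -
    have "pmf (geom_bar m p \<bind> (\<lambda>b. return_pmf (a + (m - b)))) j =
           (\<Sum>b\<le>m. indicator {j} (a + (m - b)) * pmf (geom_bar m p) b)"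
      unfolding pmf_bind
      by (subst integral_measure_pmf_real[of "{..m}"])
         (use set_pmf_geom_bar[OF p, of m] in \<open>auto simp: pmf_return indicator_def\<close>)
    \<comment> \<open>For \<open>b \<le> m\<close>, \<open>a + (m - b) = j\<close> forces
      \<open>b = m - (j - a)\<close>, so the exponent \<open>m - b\<close> becomes
      \<open>j - a\<close>; the guards in \<open>?R\<close> handle truncated subtraction.\<close>
    also have "\<dots> = (\<Sum>b\<le>m. if b = m - (j - a) then ?R a else 0)"
      using p by (intro sum.cong) (auto simp: pmf_geom_bar' indicator_def)
    also have "\<dots> = ?R a"
      by simp
    finally show ?thesis .
  qed
  have "pmf (size_step n p i) j =
          pmf (geom_bar i p \<bind> (\<lambda>a. geom_bar m p \<bind> (\<lambda>b. return_pmf (a + (m - b))))) j"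
    by (simp add: m_def size_step_def map_pmf_def pair_pmf_def bind_assoc_pmf bind_return_pmf)
  also have "\<dots> = (\<Sum>a\<le>i. ?R a * pmf (geom_bar i p) a)"
    unfolding pmf_bind[of "geom_bar i p"] inner
    by (rule integral_measure_pmf_real) (use set_pmf_geom_bar[OF p, of i] in auto)
  also have "\<dots> = (\<Sum>a\<le>i. ?R a * (p ^ (i - a) / ?Z i))"
    using p by (simp add: pmf_geom_bar')
  finally have "size_weight n p i * pmf (size_step n p i) j =
      (\<Sum>a\<le>i. if a \<le> j \<and> j - a \<le> m then p ^ (i - a) * p ^ (j - a) else 0)"
    using Z[of i] Z[of m]
    by (simp only: m_def[symmetric] size_weight_def sum_distrib_left[of "_ * _"])
       (intro sum.cong, auto)
  also have "\<dots> = (\<Sum>a | a \<le> i \<and> a \<le> j \<and> j - a \<le> m. p ^ (i - a) * p ^ (j - a))"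
    by (rule sum.mono_neutral_cong_right) auto
  finally show ?thesis
    unfolding m_def .
qed

text \<open>Detailed balance: the bound \<open>j - a \<le> n - i\<close> amounts to
  \<open>i + j \<le> n + a\<close>, which is symmetric in \<open>i\<close> and \<open>j\<close>, as
  is the summand.\<close>

lemma size_step_reversible:
  assumes "p > 0" "i \<le> n" "j \<le> n"
  shows "size_weight n p i * pmf (size_step n p i) j = size_weight n p j * pmf (size_step n p j) i"
proof -
  have "{a. a \<le> i \<and> a \<le> j \<and> j - a \<le> n - i} = {a. a \<le> j \<and> a \<le> i \<and> i - a \<le> n - j}"
    using assms by auto
  then show ?thesis
    by (simp add: size_weight_step[OF assms(1)] mult.commute)
qed

lemma size_step_pos:
  assumes "p > 0" "i \<le> n" "j \<le> n"
  shows "pmf (size_step n p i) j > 0"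
proof -
  \<comment> \<open>The least admissible number of stayers; truncated subtraction makes it 0 when
    \<open>i + j \<le> n\<close>.\<close>
  have "i + j - n \<in> {a. a \<le> i \<and> a \<le> j \<and> j - a \<le> n - i}"
    using assms by auto
  then have "0 < size_weight n p i * pmf (size_step n p i) j"
    unfolding size_weight_step[OF assms(1)] using assms(1) by (intro sum_pos) auto
  then show ?thesis
    using size_weight_pos[OF assms(1)] by (simp add: zero_less_mult_iff)
qed

lemma set_pmf_size_step:
  assumes "p > 0" "i \<le> n"
  shows "set_pmf (size_step n p i) \<subseteq> {..n}"
  using assms set_pmf_geom_bar[OF assms(1), of i] by (auto simp: size_step_def)

text \<open>Detailed balance turns the column sum into a row sum of a stochastic kernel.\<close>

lemma size_step_stationary:
  assumes "p > 0" "j \<le> n"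
  shows "(\<Sum>i\<le>n. size_weight n p i * pmf (size_step n p i) j) = size_weight n p j"
proof -
  have "(\<Sum>i\<le>n. size_weight n p i * pmf (size_step n p i) j) =
          (\<Sum>i\<le>n. size_weight n p j * pmf (size_step n p j) i)"
    using assms by (intro sum.cong size_step_reversible) auto
  also have "\<dots> = size_weight n p j"
    using assms by (simp add: sum_distrib_left[symmetric] sum_pmf_eq_1 set_pmf_size_step)
  finally show ?thesis .
qed

section \<open>The size of community 1 under the \<open>LECS\<close> law\<close>

lemma emeasure_first_layer_labels:
  assumes "k \<ge> 1"
  shows "emeasure (first_layer n k) ({1..n} \<rightarrow>\<^sub>E {1..k}) = 1"
proof -
  let ?F = "{1..n} \<rightarrow>\<^sub>E {1..k}"
  let ?K = "\<lambda>\<pi>. measure_pmf (Pi_pmf {1..n} undefined (\<lambda>_. label_pmf k \<pi>))"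
  interpret D: prob_space "flat_dirichlet k"
    by (rule prob_space_flat_dirichlet[OF assms])
  have "emeasure (first_layer n k) ?F = (\<integral>\<^sup>+ \<pi>. emeasure (?K \<pi>) ?F \<partial>flat_dirichlet k)"
    unfolding first_layer_def
    by (rule emeasure_bind[OF D.not_empty measurable_prob_algebraD[OF measurable_first_layer_kernel]]) simp
  also have "\<dots> = (\<integral>\<^sup>+ \<pi>. 1 \<partial>flat_dirichlet k)"
  proof (rule nn_integral_cong)
    fix \<pi> assume "\<pi> \<in> space (flat_dirichlet k)"
    then have \<pi>: "\<pi> \<in> prob_simplex k" by (simp add: space_flat_dirichlet)
    have "set_pmf (Pi_pmf {1..n} undefined (\<lambda>_. label_pmf k \<pi>)) \<subseteq> ?F"
      unfolding set_Pi_pmf[OF finite_atLeastAtMost] using pmf_label_pmf[OF \<pi>]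
      by (auto simp: PiE_dflt_def set_pmf_eq PiE_iff extensional_def split: if_splits)
    then show "emeasure (?K \<pi>) ?F = 1"
      by (intro measure_pmf.emeasure_eq_1_AE) (auto simp: AE_measure_pmf_iff)
  qed
  also have "\<dots> = 1"
    by (simp add: D.emeasure_space_1)
  finally show ?thesis .
qed

text \<open>Carries \<open>emeasure_lim_component\<close> over the renumbering: layer
  \<open>Suc m\<close> is coordinate \<open>m\<close> of the limit.\<close>

lemma emeasure_LECS_layer:
  assumes "k \<ge> 1"
  shows "emeasure (LECS n k p) {g \<in> space (LECS n k p). g (Suc m) \<in> A} =
           (\<integral>\<^sup>+ g. emeasure (if m = 0 then first_layer n k else measure_pmf (next_layer n k p (g m))) A
              \<partial>LECS n k p)"
proof -
  interpret Ionescu_Tulcea "LECS_kernel n k p" "\<lambda>_. count_space UNIV"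
    by (rule Ionescu_Tulcea_LECS[OF assms])
  let ?N = "PiM {1..} (\<lambda>_. count_space UNIV :: (nat \<Rightarrow> nat) measure)"
  let ?f = "\<lambda>\<omega> :: nat \<Rightarrow> nat \<Rightarrow> nat. \<lambda>l\<in>{1..}. \<omega> (l - 1)"
  let ?Q = "\<lambda>g. if m = 0 then first_layer n k else measure_pmf (next_layer n k p (g m))"
  have "?f \<in> PiM UNIV (\<lambda>_. count_space UNIV) \<rightarrow>\<^sub>M ?N"
    by (intro measurable_restrict measurable_component_singleton) auto
  then have f: "?f \<in> PF.lim \<rightarrow>\<^sub>M ?N"
    by (simp cong: measurable_cong_sets)
  have L: "LECS n k p = distr PF.lim ?N ?f"
    by (simp add: LECS_def)
  have comp: "(\<lambda>g. g l) \<in> ?N \<rightarrow>\<^sub>M count_space UNIV" if "l \<ge> 1" for l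
    using that by (intro measurable_component_singleton) auto
  have B: "{g \<in> space ?N. g (Suc m) \<in> A} \<in> sets ?N"
    by (rule measurable_sets_Collect[OF comp]) auto
  \<comment> \<open>\<open>g m\<close> is a coordinate of the product over \<open>{1..}\<close> only
    for \<open>m \<ge> 1\<close>; at \<open>m = 0\<close> the integrand is constant.\<close>
  have Q: "(\<lambda>g. emeasure (?Q g) A) \<in> borel_measurable ?N"
  proof (cases "m = 0")
    case False
    then have "(\<lambda>g. g m) \<in> ?N \<rightarrow>\<^sub>M count_space UNIV"
      by (intro comp) simp
    from measurable_compose[OF this, of "\<lambda>h. emeasure (measure_pmf (next_layer n k p h)) A"] False
    show ?thesis by simp
  qed simp
  have "emeasure (LECS n k p) {g \<in> space (LECS n k p). g (Suc m) \<in> A} =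
          emeasure PF.lim {\<omega> \<in> space PF.lim. \<omega> m \<in> A}"
    unfolding L space_distr
    by (subst emeasure_distr[OF f B]) (auto intro!: arg_cong[where f = "emeasure _"] simp: space_PiM)
  also have "\<dots> = (\<integral>\<^sup>+ \<omega>. emeasure (LECS_kernel n k p m (restrict \<omega> {0..<m})) A \<partial>PF.lim)"
    by (rule emeasure_lim_component) simp
  also have "\<dots> = (\<integral>\<^sup>+ \<omega>. emeasure (?Q (?f \<omega>)) A \<partial>PF.lim)"
    by (intro nn_integral_cong) (auto simp: LECS_kernel_def)
  also have "\<dots> = (\<integral>\<^sup>+ g. emeasure (?Q g) A \<partial>LECS n k p)"
    unfolding L by (rule nn_integral_distr[OF f, symmetric]) (use Q in simp)
  finally show ?thesis .
qed

lemma measurable_LECS_layer [measurable]: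
  "(\<lambda>g. g (Suc m)) \<in> LECS n k p \<rightarrow>\<^sub>M count_space UNIV"
proof -
  have "(\<lambda>g. g (Suc m)) \<in> PiM {1..} (\<lambda>_. count_space UNIV :: (nat \<Rightarrow> nat) measure) \<rightarrow>\<^sub>M count_space UNIV"
    by (intro measurable_component_singleton) auto
  then show ?thesis
    by (simp add: LECS_def)
qed

lemma measurable_LECS_layer_count [measurable]:
  "(\<lambda>g. f (g (Suc m))) \<in> LECS n k p \<rightarrow>\<^sub>M count_space UNIV"
  by (rule measurable_compose[OF measurable_LECS_layer]) simp

text \<open>Supplies the label hypothesis of \<open>comm_size_next_layer_two\<close>: the first
  layer satisfies it almost surely and every transition preserves it.\<close>

lemma AE_LECS_two_labels:
  assumes p: "p > 0"
  shows "AE g in LECS n 2 p. g (Suc m) \<in> {1..n} \<rightarrow>\<^sub>E {1..2}"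
proof (induction m)
  case 0
  interpret prob_space "LECS n 2 p" by (rule prob_space_LECS) simp
  show ?case
    by (subst AE_iff_emeasure_eq_1, measurable)
       (subst emeasure_LECS_layer, simp_all add: emeasure_first_layer_labels emeasure_space_1 del: One_nat_def)
next
  case (Suc m)
  let ?F = "{1..n} \<rightarrow>\<^sub>E {1..2 :: nat}"
  interpret prob_space "LECS n 2 p" by (rule prob_space_LECS) simp
  have "emeasure (LECS n 2 p) {g \<in> space (LECS n 2 p). g (Suc (Suc m)) \<in> ?F} =
          (\<integral>\<^sup>+ g. emeasure (next_layer n 2 p (g (Suc m))) ?F \<partial>LECS n 2 p)"
    by (simp add: emeasure_LECS_layer)
  also have "\<dots> = (\<integral>\<^sup>+ g. 1 \<partial>LECS n 2 p)"
  proof (rule nn_integral_cong_AE)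
    show "AE g in LECS n 2 p. emeasure (next_layer n 2 p (g (Suc m))) ?F = 1"
      using Suc
    proof eventually_elim
      case (elim g)
      show ?case
        using set_pmf_next_layer_two[OF p elim]
        by (intro measure_pmf.emeasure_eq_1_AE) (auto simp: AE_measure_pmf_iff)
    qed
  qed
  finally show ?case
    by (subst AE_iff_emeasure_eq_1) (measurable, simp add: emeasure_space_1)
qed

lemma comm_size_le: "comm_size n g r \<le> n"
proof -
  have "comm_nodes n g r \<subseteq> {1..n}"
    by (auto simp: comm_nodes_def)
  from card_mono[OF _ this] show ?thesis
    by (simp add: comm_size_def)
qed

text \<open>Condition on layer \<open>Suc m\<close>: by lumpability the conditional probability is
  almost surely constant on each event \<open>?B i\<close>, so its integral is a finite sum.\<close>

lemma LECS_size_recursion: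
  assumes p: "p > 0"
  shows "\<P>(g in LECS n 2 p. comm_size n (g (Suc (Suc m))) 1 = j) =
           (\<Sum>i\<le>n. \<P>(g in LECS n 2 p. comm_size n (g (Suc m)) 1 = i) * pmf (size_step n p i) j)"
proof -
  interpret prob_space "LECS n 2 p" by (rule prob_space_LECS) simp
  let ?L = "LECS n 2 p"
  let ?X = "\<lambda>g :: nat \<Rightarrow> nat \<Rightarrow> nat. comm_size n (g (Suc m)) 1"
  let ?B = "\<lambda>i. {g \<in> space ?L. ?X g = i}"
  have B [measurable]: "?B i \<in> sets ?L" for i
    by measurable
  have "emeasure ?L {g \<in> space ?L. comm_size n (g (Suc (Suc m))) 1 = j} =
          (\<integral>\<^sup>+ g. emeasure (next_layer n 2 p (g (Suc m))) {h. comm_size n h 1 = j} \<partial>?L)"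
    using emeasure_LECS_layer[of 2 n p "Suc m" "{h. comm_size n h 1 = j}"] by simp
  also have "\<dots> = (\<integral>\<^sup>+ g. (\<Sum>i\<le>n. ennreal (pmf (size_step n p i) j) * indicator (?B i) g) \<partial>?L)"
  proof (rule nn_integral_cong_AE)
    show "AE g in ?L. emeasure (next_layer n 2 p (g (Suc m))) {h. comm_size n h 1 = j} =
            (\<Sum>i\<le>n. ennreal (pmf (size_step n p i) j) * indicator (?B i) g)"
      using AE_LECS_two_labels[OF p, of m n] AE_space[of ?L]
    proof eventually_elim
      case (elim g)
      have "emeasure (next_layer n 2 p (g (Suc m))) {h. comm_size n h 1 = j} =
              emeasure (map_pmf (\<lambda>h. comm_size n h 1) (next_layer n 2 p (g (Suc m)))) {j}"
        by (simp add: vimage_def)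
      also have "\<dots> = ennreal (pmf (size_step n p (?X g)) j)"
        unfolding comm_size_next_layer_two[OF p elim(1)] by (simp add: emeasure_pmf_single)
      also have "\<dots> = (\<Sum>i\<le>n. if i = ?X g then ennreal (pmf (size_step n p i) j) else 0)"
        using comm_size_le[of n "g (Suc m)" 1] by simp
      also have "\<dots> = (\<Sum>i\<le>n. ennreal (pmf (size_step n p i) j) * indicator (?B i) g)"
        using elim(2) by (intro sum.cong) (auto simp: indicator_def)
      finally show ?case .
    qed
  qed
  also have "\<dots> = (\<Sum>i\<le>n. ennreal (pmf (size_step n p i) j) * emeasure ?L (?B i))"
    using B by (subst nn_integral_sum) (auto simp: nn_integral_cmult_indicator simp del: One_nat_def)
  also have "\<dots> = ennreal (\<Sum>i\<le>n. prob (?B i) * pmf (size_step n p i) j)"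
    by (simp add: emeasure_eq_measure ennreal_mult[symmetric] mult.commute sum_nonneg)
  finally show ?thesis
    by (simp add: emeasure_eq_measure sum_nonneg)
qed

lemma LECS_size_total:
  "(\<Sum>i\<le>n. \<P>(g in LECS n 2 p. comm_size n (g (Suc m)) 1 = i)) = 1"
proof -
  interpret prob_space "LECS n 2 p" by (rule prob_space_LECS) simp
  let ?L = "LECS n 2 p"
  let ?B = "\<lambda>i. {g \<in> space ?L. comm_size n (g (Suc m)) 1 = i}"
  have "(\<Sum>i\<le>n. prob (?B i)) = prob (\<Union>i\<le>n. ?B i)"
    by (rule finite_measure_finite_Union[symmetric]) (auto simp: disjoint_family_on_def simp del: One_nat_def)
  also have "(\<Union>i\<le>n. ?B i) = space ?L"
    using comm_size_le by auto
  finally show ?thesis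
    by (simp add: prob_space)
qed

theorem theorem4p1:
  fixes n i :: nat and p :: real
  assumes "n \<ge> 1" and "0 < p" and "p < 1" and "i \<le> n"
  shows "(\<lambda>l. \<P>(g in LECS n 2 p. comm_size n (g l) 1 = i)) \<longlonglongrightarrow>
           (1 - p ^ (i + 1)) * (1 - p ^ (n - i + 1)) /
             (\<Sum>j = 0..n. (1 - p ^ (j + 1)) * (1 - p ^ (n - j + 1)))"
proof -
  let ?W = "\<Sum>j\<le>n. size_weight n p j"
  let ?q = "\<lambda>l i. \<P>(g in LECS n 2 p. comm_size n (g l) 1 = i)"
  have W: "?W > 0"
    using assms(2) by (intro sum_pos size_weight_pos) auto
  \<comment> \<open>The layers start at 1, so the chain at time \<open>l\<close> is layer
    \<open>Suc l\<close>; \<open>LIMSEQ_imp_Suc\<close> undoes the shift at the end.\<close>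
  have "(\<lambda>l. ?q (Suc l) i) \<longlonglongrightarrow> size_weight n p i / ?W"
  proof (rule positive_kernel_tendsto_stationary[where S = "{..n}" and
            K = "\<lambda>i j. pmf (size_step n p i) j" and q = "\<lambda>l. ?q (Suc l)"])
    show "(\<Sum>i\<le>n. size_weight n p i / ?W * pmf (size_step n p i) j) = size_weight n p j / ?W"
      if "j \<in> {..n}" for j
      using size_step_stationary[OF assms(2), of j n] that by (simp add: sum_divide_distrib[symmetric])
    show "(\<Sum>i\<le>n. size_weight n p i / ?W) = 1"
      using W by (simp add: sum_divide_distrib[symmetric])
  qed (use assms in \<open>auto simp: LECS_size_recursion LECS_size_total size_step_pos
         sum_pmf_eq_1 set_pmf_size_step simp del: One_nat_def\<close>)
  \<comment> \<open>Expanding by \<open>(1 - p)\<^sup>2\<close>, nonzero since \<open>p < 1\<close>,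
    prepares \<open>size_weight_eq\<close> in numerator and denominator.\<close>
  also have "size_weight n p i / ?W = (1 - p)\<^sup>2 * size_weight n p i / ((1 - p)\<^sup>2 * ?W)"
    using assms(3) by simp
  also have "\<dots> = (1 - p ^ (i + 1)) * (1 - p ^ (n - i + 1)) /
      (\<Sum>j = 0..n. (1 - p ^ (j + 1)) * (1 - p ^ (n - j + 1)))"
    by (simp only: sum_distrib_left size_weight_eq atLeast0AtMost)
  finally show ?thesis
    by (rule LIMSEQ_imp_Suc)
qed

end
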